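(* Let $(\Omega,\mathcal{H},\hat{\mathbb{E}})$ be a regular sublinear expectation space with representing set of probability measures $\mathcal{P}$ and upper capacity $\hat V$. Let $n,d\ge 1$ and let $\{X_i\}_{i=1}^n\subset L^2(\Omega;\mathbb{R}^d)$ be independent under $\hat{\mathbb{E}}$ with $|X_i|\le M$ a.s. for all $i\le n$, where $M>0$ is a constant. Then for every $t>0$, \[ \hat V\!\left(\rho_\Theta\!\left(\frac1n\sum_{i=1}^n X_i\right)>t\right)\le (d+1)\,\exp\!\left(-\frac{nt^2}{2\bar\sigma_n^2+\frac{4Mt}{3}}\right). \]
   Context: $\Omega$ is a complete separable metric space and $\mathcal{H}=C_{b.\mathrm{Lip}}(\Omega)$ is the space of bounded Lipschitz real functions on $\Omega$. A regular sublinear expectation is a functional $\hat{\mathbb{E}}:\mathcal{H}\to\mathbb{R}$ that is monotone, constant preserving, subadditive and positively homogeneous, and such that $X_k\in\mathcal{H}$, $X_k\downarrow 0$ implies $\hat{\mathbb{E}}[X_k]\downarrow 0$. By a known representation theorem there is a convex, weakly compact set $\mathcal{P}$ of probability measures on $(\Omega,\mathcal{B}(\Omega))$ with $\hat{\mathbb{E}}[X]=\sup_{P\in\mathcal{P}}E_P[X]$ for $X\in\mathcal{H}$; fix this $\mathcal{P}$. The upper capacity is $\hat V(A)=\sup_{P\in\mathcal{P}}P(A)$. $L^p(\Omega)$ is the completion of $\mathcal{H}$ under $\|X\|_p=(\hat{\mathbb{E}}[|X|^p])^{1/p}$, and $L^p(\Omega;\mathbb{R}^d)$ denotes $\mathbb{R}^d$-valued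 vectors with components in $L^p(\Omega)$; $\hat{\mathbb{E}}$ and the representation extend to $L^1(\Omega)$. "a.s." without a specified measure means $P$-a.s. for every $P\in\mathcal{P}$. Independence: $\{X_i\}_{i=1}^n\subset L^1(\Omega;\mathbb{R}^d)$ is independent under $\hat{\mathbb{E}}$ if for each $1\le i\le n-1$ and every $\psi\in C_{b.\mathrm{Lip}}(\mathbb{R}^{d(i+1)})$, $\hat{\mathbb{E}}[\psi(X_1,\dots,X_i,X_{i+1})]=\hat{\mathbb{E}}\big[\hat{\mathbb{E}}[\psi(x_1,\dots,x_i,X_{i+1})]\big|_{(x_1,\dots,x_i)=(X_1,\dots,X_i)}\big]$. $|\cdot|$ and $\langle\cdot,\cdot\rangle$ are the Euclidean norm and inner product. For each $i$, $\Theta_i=\{\theta\in\mathbb{R}^d:\langle\theta,p\rangle\le\hat{\mathbb{E}}[\langle p,X_i\rangle]\ \forall p\in\mathbb{R}^d\}$, a convex compact set, known to equal $\{E_P[X_i]:P\in\mathcal{P}\}$ for independent $X_i$ in $L^2$. Further, $\Theta=\{\frac1n\sum_{i=1}^n\theta_i:\theta_i\in\Theta_i\}$, $\rho_\Theta(x)=\inf_{\theta\in\Theta}|x-\theta|$, and $\bar\sigma_n^2=\sup_{i\le n}\inf_{\theta_i\in\Theta_i}\hat{\mathbb{E}}[|X_i-\theta_i|^2]$. *)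

theory Defs
  imports "HOL-Probability.Probability"
begin

definition bLip :: "('a::metric_space \<Rightarrow> real) set" where
  "bLip = {f. bounded (range f) \<and> (\<exists>L. L-lipschitz_on UNIV f)}"

definition regular_sublinear_expectation :: "(('a::metric_space \<Rightarrow> real) \<Rightarrow> real) \<Rightarrow> bool" where
  "regular_sublinear_expectation E \<longleftrightarrow>
     (\<forall>X\<in>bLip. \<forall>Y\<in>bLip. (\<forall>\<omega>. X \<omega> \<le> Y \<omega>) \<longrightarrow> E X \<le> E Y) \<and>
     (\<forall>c. E (\<lambda>_. c) = c) \<and>
     (\<forall>X\<in>bLip. \<forall>Y\<in>bLip. E (\<lambda>\<omega>. X \<omega> + Y \<omega>) \<le> E X + E Y) \<and>
     (\<forall>X\<in>bLip. \<forall>c\<ge>0. E (\<lambda>\<omega>. c * X \<omega>) = c * E X) \<and>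
     (\<forall>Xs. (\<forall>k. Xs k \<in> bLip) \<and> (\<forall>\<omega>. decseq (\<lambda>k. Xs k \<omega>)) \<and> (\<forall>\<omega>. (\<lambda>k. Xs k \<omega>) \<longlonglongrightarrow> 0)
        \<longrightarrow> decseq (\<lambda>k. E (Xs k)) \<and> (\<lambda>k. E (Xs k)) \<longlonglongrightarrow> 0)"

definition borel_probs :: "'a::topological_space measure set" where
  "borel_probs = {P. prob_space P \<and> sets P = sets borel}"

definition weak_topology :: "'a::topological_space measure topology" where
  "weak_topology = topology_generated_by
     {{P \<in> borel_probs. (\<integral>\<omega>. f \<omega> \<partial>P) \<in> U} | f (U::real set).
        continuous_on UNIV f \<and> bounded (range f) \<and> open U}"

(* R below is the mixture u P + (1 - u) Q, which its values on the Borel sets determine. *)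
definition convex_measures :: "'a::topological_space measure set \<Rightarrow> bool" where
  "convex_measures \<P> \<longleftrightarrow>
     (\<forall>P\<in>\<P>. \<forall>Q\<in>\<P>. \<forall>u\<in>{0..1}. \<forall>R\<in>borel_probs.
        (\<forall>A\<in>sets borel. measure R A = u * measure P A + (1 - u) * measure Q A) \<longrightarrow> R \<in> \<P>)"

definition upper_expectation :: "'a measure set \<Rightarrow> ('a \<Rightarrow> real) \<Rightarrow> real" where
  "upper_expectation \<P> X = (SUP P\<in>\<P>. \<integral>\<omega>. X \<omega> \<partial>P)"

definition represents ::
  "'a::metric_space measure set \<Rightarrow> (('a \<Rightarrow> real) \<Rightarrow> real) \<Rightarrow> bool" where
  "represents \<P> E \<longleftrightarrow>
     \<P> \<subseteq> borel_probs \<and> convex_measures \<P> \<and> compactin weak_topology \<P> \<and>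
     (\<forall>X\<in>bLip. E X = upper_expectation \<P> X)"

definition upper_capacity :: "'a measure set \<Rightarrow> 'a set \<Rightarrow> real" where
  "upper_capacity \<P> A = (SUP P\<in>\<P>. measure P A)"

(* The p-th power of the L^p norm of X - Y. *)
definition Lp_dist_pow :: "'a measure set \<Rightarrow> real \<Rightarrow> ('a \<Rightarrow> real) \<Rightarrow> ('a \<Rightarrow> real) \<Rightarrow> ennreal" where
  "Lp_dist_pow \<P> p X Y = (SUP P\<in>\<P>. \<integral>\<^sup>+\<omega>. ennreal (\<bar>X \<omega> - Y \<omega>\<bar> powr p) \<partial>P)"

(* The completion of bLip, realized by Borel representatives: the functions that are limits of
   sequences in bLip under the L^p norm.  Representatives of the same element agree P-a.s.
   for every P. *)
definition Lp :: "'a::metric_space measure set \<Rightarrow> real \<Rightarrow> ('a \<Rightarrow> real) set" where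
  "Lp \<P> p = {X \<in> borel_measurable borel.
     \<exists>Xs. (\<forall>k. Xs k \<in> bLip) \<and> (\<lambda>k. Lp_dist_pow \<P> p X (Xs k)) \<longlonglongrightarrow> 0}"

definition Lp_vec :: "'a::metric_space measure set \<Rightarrow> real \<Rightarrow> ('a \<Rightarrow> real^'d) set" where
  "Lp_vec \<P> p = {X. \<forall>j. (\<lambda>\<omega>. X \<omega> $ j) \<in> Lp \<P> p}"

(* On the completion under the L^1 norm, upper_expectation is the continuous extension of E. *)
lemma upper_expectation_extends:
  fixes E :: "('a::metric_space \<Rightarrow> real) \<Rightarrow> real"
  assumes E: "regular_sublinear_expectation E" and rep: "represents \<P> E"
    and X: "X \<in> Lp \<P> 1"
    and Xs: "\<And>k. Xs k \<in> bLip" "(\<lambda>k. Lp_dist_pow \<P> 1 X (Xs k)) \<longlonglongrightarrow> 0"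
  shows "(\<lambda>k. E (Xs k)) \<longlonglongrightarrow> upper_expectation \<P> X"
proof -
  have probs: "prob_space P" "sets P = sets borel" if "P \<in> \<P>" for P
    using rep that by (auto simp: represents_def borel_probs_def)
  have Erep: "E Y = (SUP P\<in>\<P>. \<integral>\<omega>. Y \<omega> \<partial>P)" if "Y \<in> bLip" for Y
    using rep that by (auto simp: represents_def upper_expectation_def)
  have const: "(\<lambda>_. c) \<in> bLip" for c :: real
    by (auto simp: bLip_def intro!: exI[of _ 0] lipschitz_onI)
  have ne: "\<P> \<noteq> {}"
  proof
    assume "\<P> = {}"
    then have "E (\<lambda>_. 0) = E (\<lambda>_. 1)" using Erep[OF const] by simp
    moreover have "E (\<lambda>_. c) = c" for c
      using E by (simp add: regular_sublinear_expectation_def)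
    ultimately show False by simp
  qed
  have Xm: "X \<in> borel_measurable P" if "P \<in> \<P>" for P
    using X probs(2)[OF that] by (simp add: Lp_def cong: measurable_cong_sets)
  have Xsc: "continuous_on UNIV (Xs k)" for k
    using Xs(1)[of k] by (auto simp: bLip_def intro: lipschitz_on_continuous_on)
  have Xsm: "Xs k \<in> borel_measurable P" if "P \<in> \<P>" for P k
    using borel_measurable_continuous_onI[OF Xsc[of k]] probs(2)[OF that]
    by (simp cong: measurable_cong_sets)
  obtain B where B: "\<And>k \<omega>. \<bar>Xs k \<omega>\<bar> \<le> B k"
  proof -
    have "\<exists>b. \<forall>\<omega>. \<bar>Xs k \<omega>\<bar> \<le> b" for k
      using Xs(1)[of k] by (auto simp: bLip_def bounded_iff)
    then show ?thesis using that by metis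
  qed
  have Xsi: "integrable P (Xs k)" if P: "P \<in> \<P>" for P k
  proof -
    interpret prob_space P using probs(1)[OF P] .
    show ?thesis by (rule integrable_const_bound[of _ "B k"]) (use B Xsm[OF P] in auto)
  qed
  have Xs_le: "(\<integral>\<omega>. Xs k \<omega> \<partial>P) \<le> E (Xs k)" if P: "P \<in> \<P>" for P k
  proof -
    have "(\<integral>\<omega>. Xs k \<omega> \<partial>Q) \<le> B k" if Q: "Q \<in> \<P>" for Q
    proof -
      interpret prob_space Q using probs(1)[OF Q] .
      have "Xs k \<omega> \<le> B k" for \<omega> using B[of k \<omega>] by simp
      then show ?thesis by (intro integral_le_const Xsi Q) auto
    qed
    then have "bdd_above ((\<lambda>P. \<integral>\<omega>. Xs k \<omega> \<partial>P) ` \<P>)" by (intro bdd_aboveI2)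
    then show ?thesis unfolding Erep[OF Xs(1)] by (rule cSUP_upper[OF P])
  qed
  define D where "D k = enn2real (Lp_dist_pow \<P> 1 X (Xs k))" for k
  have key: "\<bar>E (Xs k) - upper_expectation \<P> X\<bar> \<le> D k" if fin: "Lp_dist_pow \<P> 1 X (Xs k) < \<infinity>" for k
  proof -
    have diff: "\<bar>(\<integral>\<omega>. X \<omega> \<partial>P) - (\<integral>\<omega>. Xs k \<omega> \<partial>P)\<bar> \<le> D k" if P: "P \<in> \<P>" for P
    proof -
      have "(\<integral>\<^sup>+\<omega>. ennreal \<bar>X \<omega> - Xs k \<omega>\<bar> \<partial>P) \<le> Lp_dist_pow \<P> 1 X (Xs k)"
        unfolding Lp_dist_pow_def by (rule SUP_upper2[OF P]) (simp add: powr_one_gt_zero_iff)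
      then have le: "(\<integral>\<^sup>+\<omega>. ennreal \<bar>X \<omega> - Xs k \<omega>\<bar> \<partial>P) \<le> ennreal (D k)"
        using fin by (simp add: D_def)
      have i: "integrable P (\<lambda>\<omega>. X \<omega> - Xs k \<omega>)"
        by (rule integrableI_bounded)
          (use le Xm[OF P] Xsm[OF P] in \<open>auto simp: le_less_trans\<close>)
      then have iX: "integrable P X"
        using Bochner_Integration.integrable_add[OF i Xsi[OF P, of k]] by simp
      have "\<bar>\<integral>\<omega>. X \<omega> - Xs k \<omega> \<partial>P\<bar> \<le> (\<integral>\<omega>. \<bar>X \<omega> - Xs k \<omega>\<bar> \<partial>P)"
        by (rule integral_abs_bound)
      also have "\<dots> = enn2real (\<integral>\<^sup>+\<omega>. ennreal \<bar>X \<omega> - Xs k \<omega>\<bar> \<partial>P)"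
        by (rule integral_eq_nn_integral) (use Xm[OF P] Xsm[OF P] in auto)
      also have "\<dots> \<le> D k"
        using enn2real_mono[OF le] by (simp add: D_def)
      finally show ?thesis
        by (simp add: Bochner_Integration.integral_diff[OF iX Xsi[OF P]])
    qed
    have up: "(\<integral>\<omega>. X \<omega> \<partial>P) \<le> E (Xs k) + D k" if P: "P \<in> \<P>" for P
      using diff[OF P] Xs_le[OF P, of k] by linarith
    have 1: "upper_expectation \<P> X \<le> E (Xs k) + D k"
      unfolding upper_expectation_def by (rule cSUP_least[OF ne up])
    have bdd: "bdd_above ((\<lambda>P. \<integral>\<omega>. X \<omega> \<partial>P) ` \<P>)" using up by (rule bdd_aboveI2)
    have "(\<integral>\<omega>. Xs k \<omega> \<partial>P) \<le> upper_expectation \<P> X + D k" if P: "P \<in> \<P>" for P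
      using diff[OF P] cSUP_upper[OF P bdd] unfolding upper_expectation_def by linarith
    then have 2: "E (Xs k) \<le> upper_expectation \<P> X + D k"
      unfolding Erep[OF Xs(1)] by (rule cSUP_least[OF ne])
    show ?thesis using 1 2 by linarith
  qed
  have "D \<longlonglongrightarrow> 0"
    unfolding D_def by (rule tendsto_enn2real) (use Xs(2) in auto)
  moreover have "eventually (\<lambda>k. Lp_dist_pow \<P> 1 X (Xs k) < \<infinity>) sequentially"
    by (rule order_tendstoD(2)[OF Xs(2)]) simp
  then have "eventually (\<lambda>k. norm (E (Xs k) - upper_expectation \<P> X) \<le> D k) sequentially"
    by eventually_elim (use key in auto)
  ultimately have "(\<lambda>k. E (Xs k) - upper_expectation \<P> X) \<longlonglongrightarrow> 0"
    by (rule Lim_null_comparison[rotated])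
  then show ?thesis by (simp add: LIM_zero_iff)
qed

(* Bounded Lipschitz functions of k vectors x 1, ..., x k.  L2_set gives the Euclidean distance
   of the concatenated vectors, so the Lipschitz bound also says that psi ignores the other
   entries of x. *)
definition bLip_block :: "nat \<Rightarrow> ((nat \<Rightarrow> 'b::euclidean_space) \<Rightarrow> real) set" where
  "bLip_block k = {\<psi>. bounded (range \<psi>) \<and>
     (\<exists>L. \<forall>x y. \<bar>\<psi> x - \<psi> y\<bar> \<le> L * L2_set (\<lambda>j. dist (x j) (y j)) {1..k})}"

definition independent_under ::
  "'a measure set \<Rightarrow> nat \<Rightarrow> (nat \<Rightarrow> 'a \<Rightarrow> 'b::euclidean_space) \<Rightarrow> bool" where
  "independent_under \<P> n X \<longleftrightarrow>
     (\<forall>i\<in>{1..<n}. \<forall>\<psi>\<in>bLip_block (Suc i).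
        upper_expectation \<P> (\<lambda>\<omega>. \<psi> (\<lambda>j. X j \<omega>)) =
        upper_expectation \<P> (\<lambda>\<omega>. upper_expectation \<P>
          (\<lambda>\<omega>'. \<psi> ((\<lambda>j. X j \<omega>)(Suc i := X (Suc i) \<omega>')))))"

definition mean_set :: "'a measure set \<Rightarrow> ('a \<Rightarrow> 'b::euclidean_space) \<Rightarrow> 'b set" where
  "mean_set \<P> Y = {\<theta>. \<forall>p. \<theta> \<bullet> p \<le> upper_expectation \<P> (\<lambda>\<omega>. p \<bullet> Y \<omega>)}"

definition avg_mean_set ::
  "'a measure set \<Rightarrow> nat \<Rightarrow> (nat \<Rightarrow> 'a \<Rightarrow> 'b::euclidean_space) \<Rightarrow> 'b set" where
  "avg_mean_set \<P> n X =
     {(1 / real n) *\<^sub>R (\<Sum>i=1..n. \<theta> i) | \<theta>. \<forall>i\<in>{1..n}. \<theta> i \<in> mean_set \<P> (X i)}"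

definition max_variance ::
  "'a measure set \<Rightarrow> nat \<Rightarrow> (nat \<Rightarrow> 'a \<Rightarrow> 'b::euclidean_space) \<Rightarrow> real" where
  "max_variance \<P> n X = (SUP i\<in>{1..n}. INF \<theta>\<in>mean_set \<P> (X i).
     upper_expectation \<P> (\<lambda>\<omega>. (norm (X i \<omega> - \<theta>))\<^sup>2))"

end

theory Submission
  imports Defs
begin

text \<open>
  The dimension-free constant 2 is at most \<open>d + 1\<close>, and it comes from Pinelis' inequality
  \<open>E cosh |v + Y| \<le> cosh |v| \<cdot> E (exp |Y| - |Y|)\<close> for centred \<open>Y\<close> in a Hilbert space.
  Write \<open>K\<^sub>i = \<Theta>\<^sub>1 + \<dots> + \<Theta>\<^sub>i\<close> and \<open>S\<^sub>i = X\<^sub>1 + \<dots> + X\<^sub>i\<close>. For every \<open>P\<close> the mean of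
  \<open>X\<^sub>i\<^sub>+\<^sub>1\<close> lies in \<open>\<Theta>\<^sub>i\<^sub>+\<^sub>1\<close>, so moving the point of \<open>K\<^sub>i\<close> nearest to \<open>S\<^sub>i\<close> by this mean
  and applying Pinelis' inequality shows that adding \<open>X\<^sub>i\<^sub>+\<^sub>1\<close> multiplies the upper expectation
  of \<open>cosh (l \<rho>(S\<^sub>i, K\<^sub>i))\<close> by at most a Bernstein factor. Independence iterates this bound
  without any conditional expectation, and Markov's inequality concludes.
\<close>

section \<open>Scalar inequalities for exp, cosh and sinh, and Pinelis' inequality\<close>

text \<open>After clearing the denominator, the difference \<open>h\<close> of the two sides
  satisfies \<open>h 0 = h' 0 = 0\<close>, and its second derivative
  \<open>(1 + (y - 1) * exp y) / 3\<close> is nonnegative because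
  \<open>1 - y \<le> exp (- y)\<close>. The 3 in the denominator is the one in Bernstein's
  inequality.\<close>

lemma exp_remainder_le:
  fixes x :: real
  assumes x: "0 \<le> x" "x < 3"
  shows "exp x - 1 - x \<le> x\<^sup>2 / (2 * (1 - x / 3))"
proof -
  define h where "h y = y\<^sup>2 / 2 - (1 - y / 3) * (exp y - 1 - y)" for y :: real
  define h' where "h' y = y - (exp y - 1) + (exp y - 1 - y) / 3 + y / 3 * (exp y - 1)" for y :: real
  have dh: "(h has_real_derivative h' y) (at y)" for y
    unfolding h_def h'_def by (rule derivative_eq_intros refl | simp)+ (simp add: field_simps)
  have dh': "(h' has_real_derivative (1 + (y - 1) * exp y) / 3) (at y)" for y
    unfolding h'_def by (rule derivative_eq_intros refl | simp)+ (simp add: field_simps)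
  have "(1 - y) * exp y \<le> 1" for y :: real
    using mult_right_mono[OF exp_ge_add_one_self[of "- y"], of "exp y"]
    by (simp flip: exp_add)
  then have pos: "0 \<le> (1 + (y - 1) * exp y) / 3" for y :: real
    by (simp add: algebra_simps)
  have "0 \<le> h' y" if "0 \<le> y" for y
  proof -
    have "h' 0 \<le> h' y"
      by (rule DERIV_nonneg_imp_nondecreasing[OF that]) (use dh' pos in blast)
    then show ?thesis by (simp add: h'_def)
  qed
  then have "h 0 \<le> h x"
    by (intro DERIV_nonneg_imp_nondecreasing[OF x(1)]) (use dh in blast)
  then have "(exp x - 1 - x) * (1 - x / 3) \<le> x\<^sup>2 / 2"
    by (simp add: h_def mult.commute)
  then show ?thesis using x by (simp add: field_simps)
qed

text \<open>Multiplying \<open>(1 - x) * exp x \<le> 1\<close> by \<open>1 + x\<close> gives the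
  claim. This crude bound has no pole at \<open>x = 3\<close> and serves the case of zero
  variance.\<close>

lemma exp_remainder_le_exp:
  fixes x :: real
  assumes x: "0 \<le> x"
  shows "exp x - 1 - x \<le> exp x * x\<^sup>2"
proof -
  have "(1 - x) * exp x \<le> 1"
    using mult_right_mono[OF exp_ge_add_one_self[of "- x"], of "exp x"]
    by (simp flip: exp_add)
  then have "(1 + x) * ((1 - x) * exp x) \<le> (1 + x) * 1"
    using x by (intro mult_left_mono) auto
  then show ?thesis by (simp add: algebra_simps power2_eq_square)
qed

text \<open>The power series of cosh has only even terms, so in \<open>z\<close> it is the sum of
  \<open>z ^ k / fact (2 * k)\<close>: every term is convex on the half-line and convexity passes to
  the sum.\<close>

lemma convex_on_cosh_sqrt: "convex_on {0..} (\<lambda>z. cosh (sqrt z))"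
proof (rule convex_onI)
  fix u x y :: real
  assume u: "0 < u" "u < 1" and xy: "x \<in> {0..}" "y \<in> {0..}"
  define c where "c z n = (if even n then sqrt z ^ n /\<^sub>R fact n else 0)" for z n
  have c: "c z sums cosh (sqrt z)" for z
    unfolding c_def by (rule cosh_converges)
  have z: "0 \<le> (1 - u) * x + u * y" using u xy by auto
  have "c ((1 - u) * x + u * y) n \<le> (1 - u) * c x n + u * c y n" for n
  proof (cases "even n")
    case True
    then obtain k where k: "n = 2 * k" by blast
    have s: "sqrt z ^ n = z ^ k" if "0 \<le> z" for z
      using that by (simp add: k power_mult)
    have "convex_on {0::real..} (\<lambda>z. z ^ k)"
      by (cases "even k") (auto intro: convex_on_subset[OF convex_power_even] convex_power_odd)
    then have "((1 - u) * x + u * y) ^ k \<le> (1 - u) * x ^ k + u * y ^ k"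
      using convex_onD[of "{0..}" "\<lambda>z. z ^ k" u x y] u xy by simp
    then have "((1 - u) * x + u * y) ^ k / fact n \<le> ((1 - u) * x ^ k + u * y ^ k) / fact n"
      by (rule divide_right_mono) simp
    then show ?thesis
      using True z xy by (simp add: c_def s field_simps)
  qed (simp add: c_def)
  then have "cosh (sqrt ((1 - u) * x + u * y)) \<le> (1 - u) * cosh (sqrt x) + u * cosh (sqrt y)"
    by (intro sums_le[OF _ c sums_add[OF sums_mult[OF c] sums_mult[OF c]]])
  then show "cosh (sqrt ((1 - u) *\<^sub>R x + u *\<^sub>R y)) \<le> (1 - u) * cosh (sqrt x) + u * cosh (sqrt y)"
    by simp
qed simp

lemma real_le_sinh:
  fixes x :: real
  assumes "0 \<le> x"
  shows "x \<le> sinh x"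
proof -
  have "sinh 0 - 0 \<le> sinh x - x"
    by (rule DERIV_nonneg_imp_nondecreasing[OF assms])
      (auto intro!: exI derivative_eq_intros simp: cosh_real_ge_1)
  then show ?thesis by simp
qed

text \<open>
  The left side is convex in \<open>v \<bullet> y\<close> and the right side affine, so it suffices to
  check parallel \<open>v\<close> and \<open>y\<close>.
\<close>

lemma cosh_norm_add_le:
  fixes v y :: "'b::real_inner"
  shows "cosh (norm (v + y)) \<le> cosh (norm v) + sinh (norm v) / norm v * (v \<bullet> y)
           + cosh (norm v) * (exp (norm y) - 1 - norm y)"
proof -
  define a b where "a = norm v" and "b = norm y"
  have ab: "0 \<le> a" "0 \<le> b" by (auto simp: a_def b_def)
  have c: "\<bar>v \<bullet> y\<bar> \<le> a * b"
    unfolding a_def b_def by (rule Cauchy_Schwarz_ineq2)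
  \<comment> \<open>The parameter \<open>u\<close> measures the angle: 0 is antiparallel, 1 is
    parallel, and the squared norm of \<open>v + y\<close> interpolates affinely between
    \<open>(a - b)\<^sup>2\<close> and \<open>(a + b)\<^sup>2\<close>. If \<open>a * b = 0\<close>,
    the inner product vanishes and any \<open>u\<close> will do.\<close>
  obtain u where u: "0 \<le> u" "u \<le> 1" and vy: "v \<bullet> y = (2 * u - 1) * (a * b)"
  proof (cases "a * b = 0")
    case True
    then show ?thesis using c that[of 0] by auto
  next
    case False
    then have p: "0 < a * b" using ab by (simp add: less_le)
    define r where "r = v \<bullet> y / (a * b)"
    have r: "v \<bullet> y = r * (a * b)" using False by (simp add: r_def)
    then have "\<bar>r\<bar> * (a * b) \<le> 1 * (a * b)"
      using c ab by (simp add: abs_mult)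
    then have "\<bar>r\<bar> \<le> 1" using p by (rule mult_right_le_imp_le)
    then show ?thesis using r by (intro that[of "(r + 1) / 2"]) (simp_all add: abs_le_iff add_divide_distrib)
  qed
  have "norm (v + y) = sqrt ((1 - u) * (a - b)\<^sup>2 + u * (a + b)\<^sup>2)"
  proof -
    have "(norm (v + y))\<^sup>2 = a\<^sup>2 + b\<^sup>2 + 2 * (v \<bullet> y)"
      by (simp add: a_def b_def power2_norm_eq_inner inner_add inner_commute)
    also have "\<dots> = (1 - u) * (a - b)\<^sup>2 + u * (a + b)\<^sup>2"
      by (simp add: vy power2_eq_square algebra_simps)
    finally show ?thesis by (metis norm_ge_zero real_sqrt_unique)
  qed
  then have "cosh (norm (v + y)) \<le> (1 - u) * cosh (a - b) + u * cosh (a + b)"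
    using convex_onD[OF convex_on_cosh_sqrt, of u "(a - b)\<^sup>2" "(a + b)\<^sup>2"] u by simp
  also have "\<dots> = cosh a * cosh b + (2 * u - 1) * (sinh a * sinh b)"
    by (simp add: cosh_add cosh_diff algebra_simps)
  \<comment> \<open>Replacing \<open>sinh b\<close> by \<open>b\<close> costs at most
    \<open>cosh a * (sinh b - b)\<close>, since \<open>(2 * u - 1) * sinh a \<le> cosh a\<close>.
    The added \<open>sinh b\<close> then completes \<open>cosh b\<close> to
    \<open>exp b\<close>.\<close>
  also have "\<dots> \<le> cosh a * cosh b + (2 * u - 1) * (sinh a * b) + cosh a * (sinh b - b)"
  proof -
    have "(2 * u - 1) * sinh a \<le> 1 * sinh a"
      using u ab by (intro mult_right_mono) auto
    also have "\<dots> \<le> cosh a" by (simp add: sinh_le_cosh_real)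
    finally have "(2 * u - 1) * sinh a * (sinh b - b) \<le> cosh a * (sinh b - b)"
      using real_le_sinh[OF ab(2)] by (intro mult_right_mono) auto
    then show ?thesis by (simp add: algebra_simps)
  qed
  also have "\<dots> = cosh a + (2 * u - 1) * (sinh a * b) + cosh a * (exp b - 1 - b)"
    by (simp add: cosh_plus_sinh[symmetric] algebra_simps)
  \<comment> \<open>For \<open>a = 0\<close> the quotient is 0 by convention, and both sides are
    0.\<close>
  also have "(2 * u - 1) * (sinh a * b) = sinh a / a * (v \<bullet> y)"
    by (simp add: vy)
  finally show ?thesis by (simp add: a_def b_def)
qed

section \<open>One centred increment under a single probability measure\<close>

lemma borel_measurable_cosh [measurable (raw)]:
  fixes f :: "'a \<Rightarrow> real"
  shows "f \<in> borel_measurable M \<Longrightarrow> (\<lambda>x. cosh (f x)) \<in> borel_measurable M"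
  by (rule borel_measurable_continuous_on[of cosh]) (auto intro!: continuous_intros)

lemma borel_measurable_infdist [measurable (raw)]:
  "f \<in> borel_measurable M \<Longrightarrow> (\<lambda>x. infdist (f x) A) \<in> borel_measurable M"
  by (rule borel_measurable_continuous_on[OF continuous_on_infdist[OF continuous_on_id]])

text \<open>Integrating Pinelis' pointwise inequality removes the linear term, as \<open>Y\<close>
  is centred, and leaves the second moment. The constant \<kappa> stays abstract so that it can be
  tuned later; \<open>rem\<close> is asked for only on the range that
  \<open>l * norm (Y \<omega>)\<close> takes a.s.\<close>

lemma (in prob_space) expectation_cosh_norm_add_le:
  fixes Y :: "'a \<Rightarrow> 'b::euclidean_space"
  assumes Y[measurable]: "Y \<in> borel_measurable M"
    and bound: "AE \<omega> in M. norm (Y \<omega>) \<le> B"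
    and mean: "expectation Y = 0"
    and var: "expectation (\<lambda>\<omega>. (norm (Y \<omega>))\<^sup>2) \<le> s"
    and l: "0 \<le> l" and \<kappa>: "0 \<le> \<kappa>"
    and rem: "\<And>x. 0 \<le> x \<Longrightarrow> x \<le> l * B \<Longrightarrow> exp x - 1 - x \<le> \<kappa> * x\<^sup>2"
  shows "expectation (\<lambda>\<omega>. cosh (l * norm (v + Y \<omega>))) \<le> cosh (l * norm v) * (1 + \<kappa> * l\<^sup>2 * s)"
proof -
  have iY: "integrable M Y"
    by (rule integrable_const_bound[OF bound]) simp
  have i2: "integrable M (\<lambda>\<omega>. (norm (Y \<omega>))\<^sup>2)"
    by (rule integrable_const_bound[of _ "B\<^sup>2"]) (use bound in \<open>auto simp: power_mono\<close>)
  define K where "K = sinh (l * norm v) / norm (l *\<^sub>R v)"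
  define f where "f \<omega> = cosh (l * norm v) + K * (l\<^sup>2 * (v \<bullet> Y \<omega>))
      + cosh (l * norm v) * (\<kappa> * l\<^sup>2 * (norm (Y \<omega>))\<^sup>2)" for \<omega>
  have iv: "integrable M (\<lambda>\<omega>. v \<bullet> Y \<omega>)"
    using iY by (intro integrable_inner_right) auto
  have if': "integrable M f" unfolding f_def
    by (intro Bochner_Integration.integrable_add integrable_mult_right iv i2 integrable_const)
  have "AE \<omega> in M. cosh (l * norm (v + Y \<omega>)) \<le> f \<omega>"
    using bound
  proof eventually_elim
    case (elim \<omega>)
    have "cosh (l * norm (v + Y \<omega>)) = cosh (norm (l *\<^sub>R v + l *\<^sub>R Y \<omega>))"
      using l by (simp flip: scaleR_add_right)
    also have "\<dots> \<le> cosh (l * norm v) + K * (l\<^sup>2 * (v \<bullet> Y \<omega>))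
        + cosh (l * norm v) * (exp (l * norm (Y \<omega>)) - 1 - l * norm (Y \<omega>))"
      using cosh_norm_add_le[of "l *\<^sub>R v" "l *\<^sub>R Y \<omega>"] l
      by (simp add: K_def power2_eq_square mult.assoc)
    also have "\<dots> \<le> f \<omega>"
      unfolding f_def
      using rem[of "l * norm (Y \<omega>)"] l elim
      by (intro add_left_mono mult_left_mono)
        (auto simp: power_mult_distrib mult.assoc mult_left_mono cosh_real_nonneg)
    finally show ?case .
  qed
  \<comment> \<open>\<open>integral_mono_AE'\<close> wants integrability of the majorant
    \<open>f\<close> alone, together with its a.s. nonnegativity.\<close>
  moreover from this have "AE \<omega> in M. 0 \<le> f \<omega>"
    by eventually_elim (rule order_trans[OF cosh_real_nonneg])
  ultimately have "expectation (\<lambda>\<omega>. cosh (l * norm (v + Y \<omega>))) \<le> expectation f"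
    by (intro integral_mono_AE' if') auto
  also have "expectation f = cosh (l * norm v) + K * (l\<^sup>2 * (v \<bullet> expectation Y))
      + cosh (l * norm v) * (\<kappa> * l\<^sup>2 * expectation (\<lambda>\<omega>. (norm (Y \<omega>))\<^sup>2))"
    unfolding f_def using iv i2 iY by (simp add: prob_space)
  also have "\<dots> \<le> cosh (l * norm v) + cosh (l * norm v) * (\<kappa> * l\<^sup>2 * s)"
    using var \<kappa> by (simp add: mean mult_left_mono cosh_real_nonneg)
  finally show ?thesis by (simp add: algebra_simps)
qed

text \<open>The second moment about \<open>c\<close> is quadratic in \<open>c\<close>, with its
  vertex at the mean.\<close>

lemma (in prob_space) expectation_norm_diff_mean_le:
  fixes X :: "'a \<Rightarrow> 'b::euclidean_space"
  assumes X: "integrable M X" and X2: "integrable M (\<lambda>\<omega>. (norm (X \<omega>))\<^sup>2)"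
  shows "expectation (\<lambda>\<omega>. (norm (X \<omega> - expectation X))\<^sup>2) \<le> expectation (\<lambda>\<omega>. (norm (X \<omega> - \<theta>))\<^sup>2)"
proof -
  have iX: "integrable M (\<lambda>\<omega>. X \<omega> \<bullet> c)" for c
    using X by (intro integrable_inner_left) auto
  have "expectation (\<lambda>\<omega>. (norm (X \<omega> - c))\<^sup>2)
      = expectation (\<lambda>\<omega>. (norm (X \<omega>))\<^sup>2) - 2 * (expectation X \<bullet> c) + (norm c)\<^sup>2" for c
  proof -
    have "(norm (X \<omega> - c))\<^sup>2 = (norm (X \<omega>))\<^sup>2 - 2 * (X \<omega> \<bullet> c) + (norm c)\<^sup>2" for \<omega>
      by (simp add: power2_norm_eq_inner inner_diff inner_commute)
    then show ?thesis using iX X X2 by (simp add: prob_space)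
  qed
  moreover have "0 \<le> (norm (expectation X - \<theta>))\<^sup>2" by simp
  ultimately show ?thesis
    by (simp only:) (simp add: power2_norm_eq_inner inner_diff inner_commute)
qed

section \<open>One increment under the whole family of measures\<close>

text \<open>Real suprema dominate their members only when bounded. The sign condition on
  \<open>C\<close> covers non-integrable \<open>f\<close>, whose integral is 0 by default.\<close>

lemma bdd_above_expectations:
  fixes f :: "'a \<Rightarrow> real"
  assumes prob: "\<And>P. P \<in> \<P> \<Longrightarrow> prob_space P"
    and le: "\<And>P. P \<in> \<P> \<Longrightarrow> AE \<omega> in P. f \<omega> \<le> C" and C: "0 \<le> C"
  shows "bdd_above ((\<lambda>P. \<integral>\<omega>. f \<omega> \<partial>P) ` \<P>)"
proof (rule bdd_aboveI2)
  fix P assume P: "P \<in> \<P>"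
  interpret prob_space P using prob[OF P] .
  have "(\<integral>\<omega>. f \<omega> \<partial>P) \<le> (\<integral>\<omega>. C \<partial>P)"
    using le[OF P] C by (intro integral_mono_AE') auto
  then show "(\<integral>\<omega>. f \<omega> \<partial>P) \<le> C" by (simp add: prob_space)
qed

context
  fixes \<P> :: "'a measure set" and X :: "'a \<Rightarrow> 'b::euclidean_space" and M :: real
  assumes prob: "\<And>P. P \<in> \<P> \<Longrightarrow> prob_space P"
    and meas: "\<And>P. P \<in> \<P> \<Longrightarrow> X \<in> borel_measurable P"
    and bound: "\<And>P. P \<in> \<P> \<Longrightarrow> AE \<omega> in P. norm (X \<omega>) \<le> M" and M: "0 \<le> M"
begin

lemma integrable_of_norm_bound: "P \<in> \<P> \<Longrightarrow> integrable P X"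
  using prob_space.finite_measure[OF prob] bound meas
  by (intro finite_measure.integrable_const_bound[where B = M]) auto

lemma norm_expectation_le:
  assumes P: "P \<in> \<P>"
  shows "norm (\<integral>\<omega>. X \<omega> \<partial>P) \<le> M"
proof -
  interpret prob_space P using prob[OF P] .
  have "norm (\<integral>\<omega>. X \<omega> \<partial>P) \<le> (\<integral>\<omega>. norm (X \<omega>) \<partial>P)"
    by (rule integral_norm_bound)
  also have "\<dots> \<le> (\<integral>\<omega>. M \<partial>P)"
    using bound[OF P] M by (intro integral_mono_AE') auto
  finally show ?thesis by (simp add: prob_space)
qed

lemma expectation_in_mean_set:
  assumes P: "P \<in> \<P>"
  shows "(\<integral>\<omega>. X \<omega> \<partial>P) \<in> mean_set \<P> X"
  unfolding mean_set_def
proof safe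
  fix p
  have "AE \<omega> in Q. p \<bullet> X \<omega> \<le> norm p * M" if "Q \<in> \<P>" for Q
    using bound[OF that]
    by eventually_elim (meson norm_cauchy_schwarz mult_left_mono norm_ge_zero order_trans)
  then have "bdd_above ((\<lambda>Q. \<integral>\<omega>. p \<bullet> X \<omega> \<partial>Q) ` \<P>)"
    using prob M by (intro bdd_above_expectations[where C = "norm p * M"]) auto
  then have "(\<integral>\<omega>. p \<bullet> X \<omega> \<partial>P) \<le> upper_expectation \<P> (\<lambda>\<omega>. p \<bullet> X \<omega>)"
    unfolding upper_expectation_def by (rule cSUP_upper[OF P])
  moreover have "(\<integral>\<omega>. p \<bullet> X \<omega> \<partial>P) = (\<integral>\<omega>. X \<omega> \<partial>P) \<bullet> p"
    using integrable_of_norm_bound[OF P] by (simp add: inner_commute)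
  ultimately show "(\<integral>\<omega>. X \<omega> \<partial>P) \<bullet> p \<le> upper_expectation \<P> (\<lambda>\<omega>. p \<bullet> X \<omega>)"
    by simp
qed

text \<open>The mean under \<open>P\<close> is the best centre for \<open>P\<close>, and passing
  from \<open>P\<close> to the supremum over \<P> only increases the second moment about \<theta>.
  Hence the variance under each \<open>P\<close> is a lower bound for the whole infimum.\<close>

lemma expectation_norm_diff_mean_le_INF:
  assumes P: "P \<in> \<P>"
  shows "(\<integral>\<omega>. (norm (X \<omega> - (\<integral>\<omega>. X \<omega> \<partial>P)))\<^sup>2 \<partial>P)
    \<le> (INF \<theta>\<in>mean_set \<P> X. upper_expectation \<P> (\<lambda>\<omega>. (norm (X \<omega> - \<theta>))\<^sup>2))"
proof (rule cINF_greatest)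
  show "mean_set \<P> X \<noteq> {}" using expectation_in_mean_set[OF P] by blast
next
  fix \<theta>
  interpret prob_space P using prob[OF P] .
  note [measurable] = meas[OF P]
  have "integrable P (\<lambda>\<omega>. (norm (X \<omega>))\<^sup>2)"
    using bound[OF P] by (intro integrable_const_bound[where B = "M\<^sup>2"]) (auto simp: power_mono)
  then have "(\<integral>\<omega>. (norm (X \<omega> - (\<integral>\<omega>. X \<omega> \<partial>P)))\<^sup>2 \<partial>P) \<le> (\<integral>\<omega>. (norm (X \<omega> - \<theta>))\<^sup>2 \<partial>P)"
    by (rule expectation_norm_diff_mean_le[OF integrable_of_norm_bound[OF P]])
  also have "\<dots> \<le> upper_expectation \<P> (\<lambda>\<omega>. (norm (X \<omega> - \<theta>))\<^sup>2)"
    unfolding upper_expectation_def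
  proof (intro cSUP_upper[OF P] bdd_above_expectations[OF prob])
    fix Q assume "Q \<in> \<P>"
    from bound[OF this] show "AE \<omega> in Q. (norm (X \<omega> - \<theta>))\<^sup>2 \<le> (M + norm \<theta>)\<^sup>2"
    proof eventually_elim
      case (elim \<omega>)
      then show ?case
        using norm_triangle_ineq4[of "X \<omega>" \<theta>] by (intro power_mono) auto
    qed
  qed auto
  finally show "(\<integral>\<omega>. (norm (X \<omega> - (\<integral>\<omega>. X \<omega> \<partial>P)))\<^sup>2 \<partial>P)
      \<le> upper_expectation \<P> (\<lambda>\<omega>. (norm (X \<omega> - \<theta>))\<^sup>2)" .
qed

text \<open>
  The law \<open>P\<close> and the shift \<open>\<theta> = E\<^sub>P[X] \<in> \<Theta>\<close> are chosen together, so under each \<open>P\<close> the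
  increment \<open>X - \<theta>\<close> is centred.
\<close>

lemma upper_expectation_cosh_infdist_le:
  assumes ne: "\<P> \<noteq> {}"
    and var: "(INF \<theta>\<in>mean_set \<P> X. upper_expectation \<P> (\<lambda>\<omega>. (norm (X \<omega> - \<theta>))\<^sup>2)) \<le> s"
    and l: "0 \<le> l" and \<kappa>: "0 \<le> \<kappa>" and C: "0 \<le> C"
    and rem: "\<And>x. 0 \<le> x \<Longrightarrow> x \<le> l * (2 * M) \<Longrightarrow> exp x - 1 - x \<le> \<kappa> * x\<^sup>2"
    and K: "K \<noteq> {}" and K': "\<And>k \<theta>. k \<in> K \<Longrightarrow> \<theta> \<in> mean_set \<P> X \<Longrightarrow> k + \<theta> \<in> K'"
  shows "upper_expectation \<P> (\<lambda>\<omega>. cosh (l * min C (infdist (y + X \<omega>) K')))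
    \<le> cosh (l * infdist y K) * (1 + \<kappa> * l\<^sup>2 * s)"
  unfolding upper_expectation_def
proof (rule cSUP_least[OF ne])
  fix P assume P: "P \<in> \<P>"
  interpret prob_space P using prob[OF P] .
  note [measurable] = meas[OF P]
  define \<theta> where "\<theta> = expectation X"
  have \<theta>: "\<theta> \<in> mean_set \<P> X" unfolding \<theta>_def by (rule expectation_in_mean_set[OF P])
  have Y: "AE \<omega> in P. norm (X \<omega> - \<theta>) \<le> 2 * M"
    using bound[OF P]
  proof eventually_elim
    case (elim \<omega>)
    then show ?case
      using norm_triangle_ineq4[of "X \<omega>" \<theta>] norm_expectation_le[OF P] by (simp add: \<theta>_def)
  qed
  have vs: "expectation (\<lambda>\<omega>. (norm (X \<omega> - \<theta>))\<^sup>2) \<le> s"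
    using expectation_norm_diff_mean_le_INF[OF P] var by (simp add: \<theta>_def)
  moreover have "0 \<le> expectation (\<lambda>\<omega>. (norm (X \<omega> - \<theta>))\<^sup>2)" by simp
  ultimately have "0 \<le> s" by linarith
  then have D: "0 \<le> 1 + \<kappa> * l\<^sup>2 * s" using \<kappa> by simp
  \<comment> \<open>A nearest point of \<open>K\<close> need not be available, so for each
    \<open>c\<close> above the distance a point of \<open>K\<close> closer than \<open>c\<close> is
    used; finally \<open>c\<close> decreases to the distance.\<close>
  have le: "(\<integral>\<omega>. cosh (l * min C (infdist (y + X \<omega>) K')) \<partial>P) \<le> cosh (l * c) * (1 + \<kappa> * l\<^sup>2 * s)"
    if c: "infdist y K < c" for c
  proof -
    obtain k where k: "k \<in> K" "dist y k < c"
      using c K by (auto simp: infdist_notempty cINF_less_iff)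
    let ?g = "\<lambda>\<omega>. cosh (l * norm ((y - k) + (X \<omega> - \<theta>)))"
    have "AE \<omega> in P. norm (?g \<omega>) \<le> cosh (l * (norm (y - k) + 2 * M))"
      using Y
    proof eventually_elim
      case (elim \<omega>)
      then show ?case
        using norm_triangle_ineq[of "y - k" "X \<omega> - \<theta>"] l M
        by (simp add: cosh_real_nonneg_le_iff mult_left_mono)
    qed
    then have "integrable P ?g" by (rule integrable_const_bound) simp
    \<comment> \<open>The shifted point \<open>k + \<theta>\<close> is a competitor in the distance
      to \<open>K'\<close>, and truncation at \<open>C\<close> only lowers the left side.\<close>
    moreover have "cosh (l * min C (infdist (y + X \<omega>) K')) \<le> ?g \<omega>" for \<omega>
    proof -
      have "infdist (y + X \<omega>) K' \<le> dist (y + X \<omega>) (k + \<theta>)"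
        by (rule infdist_le[OF K'[OF k(1) \<theta>]])
      then have "min C (infdist (y + X \<omega>) K') \<le> norm ((y - k) + (X \<omega> - \<theta>))"
        by (simp add: dist_norm algebra_simps min.coboundedI2)
      then show ?thesis
        using l C by (simp add: cosh_real_nonneg_le_iff infdist_nonneg mult_left_mono)
    qed
    ultimately have "(\<integral>\<omega>. cosh (l * min C (infdist (y + X \<omega>) K')) \<partial>P) \<le> expectation ?g"
      by (intro integral_mono_AE') (auto simp: cosh_real_nonneg)
    also have "\<dots> \<le> cosh (l * norm (y - k)) * (1 + \<kappa> * l\<^sup>2 * s)"
      using integrable_of_norm_bound[OF P]
      by (intro expectation_cosh_norm_add_le[OF _ Y _ vs l \<kappa> rem]) (auto simp: \<theta>_def prob_space)
    also have "\<dots> \<le> cosh (l * c) * (1 + \<kappa> * l\<^sup>2 * s)"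
      using k(2) l D c infdist_nonneg[of y K]
      by (intro mult_right_mono) (auto simp: cosh_real_nonneg_le_iff dist_norm intro!: mult_left_mono)
    finally show ?thesis .
  qed
  have "((\<lambda>c. cosh (l * c) * (1 + \<kappa> * l\<^sup>2 * s)) \<longlongrightarrow>
      cosh (l * infdist y K) * (1 + \<kappa> * l\<^sup>2 * s)) (at_right (infdist y K))"
    by (intro tendsto_intros)
  then show "(\<integral>\<omega>. cosh (l * min C (infdist (y + X \<omega>) K')) \<partial>P)
      \<le> cosh (l * infdist y K) * (1 + \<kappa> * l\<^sup>2 * s)"
    by (rule tendsto_lowerbound) (use le in \<open>auto simp: eventually_at_filter\<close>)
qed

end

section \<open>Admissible test functions and Bernstein parameters\<close>

text \<open>This makes the truncated cosh admissible in the definition of independence. The distance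
  of the sum is Lipschitz with constant \<open>k\<close>, because each of the \<open>k\<close>
  entries moves by at most the Euclidean norm; on \<open>[0, C]\<close> the derivative of
  \<open>cosh (l * z)\<close> is at most \<open>l * sinh (l * C)\<close>.\<close>

lemma cosh_min_infdist_sum_in_bLip_block:
  fixes K :: "'b::euclidean_space set"
  assumes l: "0 \<le> l" and C: "0 \<le> C"
  shows "(\<lambda>x. cosh (l * min C (infdist (\<Sum>j=1..k. x j) K))) \<in> bLip_block k"
proof -
  define m where "m x = min C (infdist (\<Sum>j=1..k. x j) K)" for x :: "nat \<Rightarrow> 'b"
  have m: "m x \<in> {0..C}" for x using C by (auto simp: m_def infdist_nonneg)
  have mL: "\<bar>m x - m y\<bar> \<le> real k * L2_set (\<lambda>j. dist (x j) (y j)) {1..k}" for x y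
  proof -
    have "\<bar>m x - m y\<bar> \<le> \<bar>infdist (\<Sum>j=1..k. x j) K - infdist (\<Sum>j=1..k. y j) K\<bar>"
      by (auto simp: m_def min_def)
    also have "\<dots> \<le> dist (\<Sum>j=1..k. x j) (\<Sum>j=1..k. y j)" by (rule infdist_triangle_abs)
    also have "\<dots> = norm (\<Sum>j=1..k. x j - y j)" by (simp add: dist_norm sum_subtractf)
    also have "\<dots> \<le> (\<Sum>j=1..k. dist (x j) (y j))"
      unfolding dist_norm by (rule norm_sum)
    also have "\<dots> \<le> (\<Sum>j=1..k. L2_set (\<lambda>j. dist (x j) (y j)) {1..k})"
      by (intro sum_mono member_le_L2_set) auto
    finally show ?thesis by simp
  qed
  have cL: "\<bar>cosh (l * a) - cosh (l * b)\<bar> \<le> l * sinh (l * C) * \<bar>a - b\<bar>"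
    if "a \<in> {0..C}" "b \<in> {0..C}" for a b
  proof -
    have "norm (cosh (l * a) - cosh (l * b)) \<le> l * sinh (l * C) * norm (a - b)"
    proof (rule field_differentiable_bound[where S = "{0..C}" and f' = "\<lambda>z. l * sinh (l * z)"])
      fix z assume "z \<in> {0..C}"
      then show "norm (l * sinh (l * z)) \<le> l * sinh (l * C)"
        using l by (auto simp: abs_mult intro!: mult_left_mono)
    qed (use that in \<open>auto intro!: derivative_eq_intros\<close>)
    then show ?thesis by simp
  qed
  have "\<bar>cosh (l * m x) - cosh (l * m y)\<bar>
      \<le> (l * sinh (l * C) * real k) * L2_set (\<lambda>j. dist (x j) (y j)) {1..k}" for x y
    using cL[OF m m, of x y] mult_left_mono[OF mL[of x y], of "l * sinh (l * C)"] l C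
    by (simp add: mult.assoc)
  moreover have "\<bar>cosh (l * m x)\<bar> \<le> cosh (l * C)" for x
    using m[of x] l C by (auto simp: cosh_real_nonneg_le_iff mult_left_mono)
  then have "bounded (range (\<lambda>x. cosh (l * m x)))"
    unfolding bounded_iff by auto
  ultimately show ?thesis unfolding bLip_block_def m_def by blast
qed

text \<open>Bernstein's choice is \<open>l = t / q\<close> with
  \<open>q = s + 2 * M * t / 3\<close>. At the end point \<open>x = l * (2 * M)\<close> the factor
  \<open>1 - x / 3\<close> equals \<open>s / q\<close>, whence
  \<open>\<kappa> = q / (2 * s)\<close>, and the exponent becomes
  \<open>- t\<^sup>2 / (2 * q)\<close>. The range involves \<open>2 * M\<close> because
  \<open>X - \<theta>\<close> is bounded by twice the bound of \<open>X\<close>. For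
  \<open>s = 0\<close> the same \<open>l\<close> is \<open>3 / (2 * M)\<close>, where this formula
  for \<kappa> breaks down.\<close>

lemma ex_Bernstein_parameters:
  fixes s M t :: real
  assumes s: "0 \<le> s" and M: "0 < M" and t: "0 < t"
  obtains l \<kappa> where "0 < l" "0 \<le> \<kappa>"
    "\<And>x. 0 \<le> x \<Longrightarrow> x \<le> l * (2 * M) \<Longrightarrow> exp x - 1 - x \<le> \<kappa> * x\<^sup>2"
    "\<kappa> * l\<^sup>2 * s - l * t \<le> - (t\<^sup>2 / (2 * s + 4 * M * t / 3))"
proof (cases "s = 0")
  case True
  show ?thesis \<comment> \<open>now \<open>\<kappa>\<close> is multiplied by 0, so any crude constant will do\<close>
  proof (rule that[of "3 / (2 * M)" "exp 3"])
    fix x :: real assume x: "0 \<le> x" "x \<le> 3 / (2 * M) * (2 * M)"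
    have "exp x - 1 - x \<le> exp x * x\<^sup>2" by (rule exp_remainder_le_exp[OF x(1)])
    also have "\<dots> \<le> exp 3 * x\<^sup>2" using x M by (intro mult_right_mono) auto
    finally show "exp x - 1 - x \<le> exp 3 * x\<^sup>2" .
  qed (use True M t in \<open>auto simp: field_simps power2_eq_square\<close>)
next
  case False
  then have s: "0 < s" using s by simp
  define q where "q = s + 2 * M * t / 3"
  have q: "0 < q" using s M t by (auto simp: q_def add_pos_pos)
  show ?thesis
  proof (rule that[of "t / q" "q / (2 * s)"])
    fix x :: real assume x: "0 \<le> x" "x \<le> t / q * (2 * M)"
    have e: "1 - t / q * (2 * M) / 3 = s / q"
      using q by (simp add: q_def field_simps)
    have "x / 3 \<le> t / q * (2 * M) / 3"
      by (rule divide_right_mono[OF x(2)]) simp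
    then have x1: "s / q \<le> 1 - x / 3"
      unfolding e[symmetric] by (rule diff_left_mono)
    have x3: "0 < 1 - x / 3" by (rule less_le_trans[OF _ x1]) (use s q in simp)
    then have "exp x - 1 - x \<le> x\<^sup>2 / (2 * (1 - x / 3))"
      using x x3 by (intro exp_remainder_le) linarith+
    also have "\<dots> \<le> x\<^sup>2 / (2 * (s / q))"
      using x1 x3 s q by (intro divide_left_mono mult_pos_pos) auto
    finally show "exp x - 1 - x \<le> q / (2 * s) * x\<^sup>2" by (simp add: field_simps)
  next
    have "q / (2 * s) * (t / q)\<^sup>2 * s - t / q * t = - (t\<^sup>2 / (2 * q))"
      using s q by (simp add: field_simps power2_eq_square)
    moreover have "2 * q = 2 * s + 4 * M * t / 3" by (simp add: q_def)
    ultimately show "q / (2 * s) * (t / q)\<^sup>2 * s - t / q * t \<le> - (t\<^sup>2 / (2 * s + 4 * M * t / 3))"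
      by simp
  qed (use s q t in auto)
qed

section \<open>Minkowski sums of the mean sets\<close>

text \<open>Without the factor \<open>1 / n\<close>, these sets grow by one summand at a time, which
  suits the induction.\<close>

definition sum_mean_set ::
  "'a measure set \<Rightarrow> nat \<Rightarrow> (nat \<Rightarrow> 'a \<Rightarrow> 'b::euclidean_space) \<Rightarrow> 'b set" where
  "sum_mean_set \<P> n X = {\<Sum>i=1..n. \<theta> i | \<theta>. \<forall>i\<in>{1..n}. \<theta> i \<in> mean_set \<P> (X i)}"

lemma add_in_sum_mean_set:
  assumes "k \<in> sum_mean_set \<P> n X" "\<theta> \<in> mean_set \<P> (X (Suc n))"
  shows "k + \<theta> \<in> sum_mean_set \<P> (Suc n) X"
proof -
  obtain \<tau> where "k = (\<Sum>i=1..n. \<tau> i)" "\<forall>i\<in>{1..n}. \<tau> i \<in> mean_set \<P> (X i)"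
    using assms(1) by (auto simp: sum_mean_set_def)
  then show ?thesis using assms(2) unfolding sum_mean_set_def
    by (intro CollectI exI[of _ "\<tau>(Suc n := \<theta>)"]) auto
qed

lemma infdist_avg_mean_set:
  assumes "n \<ge> 1" "sum_mean_set \<P> n X \<noteq> {}"
  shows "infdist ((1 / real n) *\<^sub>R y) (avg_mean_set \<P> n X) = infdist y (sum_mean_set \<P> n X) / real n"
proof -
  have "avg_mean_set \<P> n X = (\<lambda>k. (1 / real n) *\<^sub>R k) ` sum_mean_set \<P> n X"
    by (auto simp: avg_mean_set_def sum_mean_set_def)
  moreover have "dist ((1 / real n) *\<^sub>R y) ((1 / real n) *\<^sub>R k) = dist y k / real n" for k
    by (simp add: dist_norm flip: scaleR_diff_right)
  ultimately have *: "infdist ((1 / real n) *\<^sub>R y) (avg_mean_set \<P> n X)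
      = (INF k\<in>sum_mean_set \<P> n X. dist y k / real n)"
    using assms by (simp add: infdist_notempty image_image)
  have "Inf (dist y ` sum_mean_set \<P> n X) / real n
      = Inf ((\<lambda>x. x / real n) ` dist y ` sum_mean_set \<P> n X)"
    using assms by (intro continuous_at_Inf_mono)
      (auto intro!: monoI divide_right_mono continuous_intros bdd_belowI2[where m = 0])
  with * show ?thesis using assms by (simp add: infdist_notempty image_image)
qed

section \<open>Iteration by independence, and Markov's inequality\<close>

lemma upper_capacity_infdist_le:
  fixes X :: "nat \<Rightarrow> 'a \<Rightarrow> 'b::euclidean_space"
  assumes ne: "\<P> \<noteq> {}" and prob: "\<And>P. P \<in> \<P> \<Longrightarrow> prob_space P" and n: "n \<ge> 1"
    and meas: "\<And>i P. i \<in> {1..n} \<Longrightarrow> P \<in> \<P> \<Longrightarrow> X i \<in> borel_measurable P"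
    and indep: "independent_under \<P> n X" and M: "M > 0"
    and bound: "\<And>i P. i \<in> {1..n} \<Longrightarrow> P \<in> \<P> \<Longrightarrow> AE \<omega> in P. norm (X i \<omega>) \<le> M"
    and t: "t > 0"
  shows "upper_capacity \<P>
           {\<omega>. infdist ((1 / real n) *\<^sub>R (\<Sum>i=1..n. X i \<omega>)) (avg_mean_set \<P> n X) > t}
         \<le> 2 * exp (- (real n * t\<^sup>2 / (2 * max_variance \<P> n X + 4 * M * t / 3)))"
proof -
  define s where "s = max_variance \<P> n X"
  define K where "K i = sum_mean_set \<P> i X" for i
  define S where "S i \<omega> = (\<Sum>j=1..i. X j \<omega>)" for i \<omega>
  \<comment> \<open>\<open>C\<close> dominates all distances a.s.; truncating there makes the test functions bounded and Lipschitz.\<close>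
  define C where "C = 2 * real n * M"
  have C: "0 \<le> C" using M by (simp add: C_def)
  obtain P\<^sub>0 where P\<^sub>0: "P\<^sub>0 \<in> \<P>" using ne by blast
  have var: "(INF \<theta>\<in>mean_set \<P> (X i). upper_expectation \<P> (\<lambda>\<omega>. (norm (X i \<omega> - \<theta>))\<^sup>2)) \<le> s"
    if "i \<in> {1..n}" for i
    unfolding s_def max_variance_def using that by (intro cSUP_upper) auto
  have s: "0 \<le> s"
  proof -
    have "0 \<le> (\<integral>\<omega>. (norm (X 1 \<omega> - (\<integral>\<omega>. X 1 \<omega> \<partial>P\<^sub>0)))\<^sup>2 \<partial>P\<^sub>0)" by simp
    also have "\<dots> \<le> (INF \<theta>\<in>mean_set \<P> (X 1). upper_expectation \<P> (\<lambda>\<omega>. (norm (X 1 \<omega> - \<theta>))\<^sup>2))"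
      using n M by (intro expectation_norm_diff_mean_le_INF[OF prob meas bound _ P\<^sub>0]) auto
    also have "\<dots> \<le> s" using var n by simp
    finally show ?thesis .
  qed
  \<comment> \<open>The means under one fixed law give an explicit point of every
    \<open>K i\<close>. It shows that these sets are nonempty and bounds the distances by
    \<open>C\<close>, each summand contributing at most \<open>2 * M\<close>.\<close>
  define \<theta> where "\<theta> i = (\<integral>\<omega>. X i \<omega> \<partial>P\<^sub>0)" for i
  have \<theta>: "\<theta> i \<in> mean_set \<P> (X i)" "norm (\<theta> i) \<le> M" if "i \<in> {1..n}" for i
    unfolding \<theta>_def using that M
    by (auto intro!: expectation_in_mean_set[OF prob meas bound _ P\<^sub>0]
        norm_expectation_le[OF prob meas bound _ P\<^sub>0])
  have sum\<theta>: "(\<Sum>j=1..i. \<theta> j) \<in> K i" if "i \<le> n" for i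
    unfolding K_def sum_mean_set_def using \<theta>(1) that by force
  have boundC: "AE \<omega> in P. infdist (S i \<omega>) (K i) \<le> C" if P: "P \<in> \<P>" and i: "i \<le> n" for P i
  proof -
    have "AE \<omega> in P. \<forall>j\<in>{1..n}. norm (X j \<omega>) \<le> M"
      using bound P by (intro AE_finite_allI) auto
    then show ?thesis
    proof eventually_elim
      case (elim \<omega>)
      have "infdist (S i \<omega>) (K i) \<le> dist (S i \<omega>) (\<Sum>j=1..i. \<theta> j)"
        by (rule infdist_le[OF sum\<theta>[OF i]])
      also have "\<dots> = norm (\<Sum>j=1..i. X j \<omega> - \<theta> j)"
        by (simp add: dist_norm S_def sum_subtractf)
      also have "\<dots> \<le> (\<Sum>j=1..i. 2 * M)"
      proof (rule sum_norm_le)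
        fix j assume "j \<in> {1..i}"
        then have "norm (X j \<omega>) \<le> M" "norm (\<theta> j) \<le> M" using elim \<theta>(2) i by auto
        then show "norm (X j \<omega> - \<theta> j) \<le> 2 * M"
          using norm_triangle_ineq4[of "X j \<omega>" "\<theta> j"] by linarith
      qed
      also have "\<dots> \<le> C" using i M by (simp add: C_def)
      finally show ?case .
    qed
  qed
  obtain l \<kappa> where l: "0 < l" and \<kappa>: "0 \<le> \<kappa>"
    and rem: "\<And>x. 0 \<le> x \<Longrightarrow> x \<le> l * (2 * M) \<Longrightarrow> exp x - 1 - x \<le> \<kappa> * x\<^sup>2"
    and opt: "\<kappa> * l\<^sup>2 * s - l * t \<le> - (t\<^sup>2 / (2 * s + 4 * M * t / 3))"
    using ex_Bernstein_parameters[OF s M t] by metis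
  define D where "D = 1 + \<kappa> * l\<^sup>2 * s"
  have D: "0 \<le> D" using \<kappa> s by (simp add: D_def)
  define \<psi> where "\<psi> i x = cosh (l * min C (infdist (\<Sum>j=1..i. x j) (K i)))"
    for i and x :: "nat \<Rightarrow> 'b"
  have one_step: "upper_expectation \<P> (\<lambda>\<omega>. cosh (l * min C (infdist (y + X (Suc i) \<omega>) (K (Suc i)))))
      \<le> cosh (l * infdist y (K i)) * D" if i: "i < n" for i y
    unfolding D_def
  proof (rule upper_expectation_cosh_infdist_le[OF prob meas bound])
    show "K i \<noteq> {}" using sum\<theta>[of i] i by auto
    show "k + \<theta> \<in> K (Suc i)" if "k \<in> K i" "\<theta> \<in> mean_set \<P> (X (Suc i))" for k \<theta>
      using that unfolding K_def by (rule add_in_sum_mean_set)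
  qed (use i ne var l \<kappa> C rem M in auto)
  have \<psi>_le: "\<psi> i x \<le> cosh (l * C)" for i x
    using l C by (simp add: \<psi>_def cosh_real_nonneg_le_iff infdist_nonneg)
  have \<psi>_upper: "(\<integral>\<omega>. \<psi> i (\<lambda>j. X j \<omega>) \<partial>P) \<le> upper_expectation \<P> (\<lambda>\<omega>. \<psi> i (\<lambda>j. X j \<omega>))"
    if "P \<in> \<P>" for P i
    unfolding upper_expectation_def
    by (rule cSUP_upper[OF that bdd_above_expectations[OF prob]]) (use \<psi>_le in auto)
  have \<psi>_int: "integrable P (\<lambda>\<omega>. \<psi> i (\<lambda>j. X j \<omega>))" if P: "P \<in> \<P>" and i: "i \<le> n" for P i
  proof -
    interpret prob_space P using prob[OF P] .
    have [measurable]: "X j \<in> borel_measurable P" if "j \<in> {1..i}" for j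
      using that i by (intro meas[OF _ P]) auto
    show ?thesis
    proof (rule integrable_const_bound)
      show "AE \<omega> in P. norm (\<psi> i (\<lambda>j. X j \<omega>)) \<le> cosh (l * C)"
        using \<psi>_le by (auto simp: \<psi>_def)
    qed (simp add: \<psi>_def)
  qed
  have \<psi>_eq: "AE \<omega> in P. \<psi> i (\<lambda>j. X j \<omega>) = cosh (l * infdist (S i \<omega>) (K i))"
    if "P \<in> \<P>" "i \<le> n" for P i
    using boundC[OF that] by eventually_elim (simp add: \<psi>_def S_def min_absorb2)
  have main: "upper_expectation \<P> (\<lambda>\<omega>. \<psi> i (\<lambda>j. X j \<omega>)) \<le> D ^ i" if "1 \<le> i" "i \<le> n" for i
    using that
  proof (induction i rule: dec_induct)
    case base
    \<comment> \<open>The independence identity starts at \<open>i = 1\<close>, so the first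
      variable is handled by \<open>one_step\<close> with \<open>y = 0\<close>, where the right-hand
      cosh is 1.\<close>
    have "K 0 = {0}" by (simp add: K_def sum_mean_set_def)
    then show ?case using one_step[of 0 0] n by (simp add: \<psi>_def)
  next
    case (step i)
    then have i: "1 \<le> i" "i < n" by auto
    let ?g = "\<lambda>\<omega>. upper_expectation \<P> (\<lambda>\<omega>'. \<psi> (Suc i) ((\<lambda>j. X j \<omega>)(Suc i := X (Suc i) \<omega>')))"
    have g: "?g \<omega> \<le> cosh (l * infdist (S i \<omega>) (K i)) * D" for \<omega>
      using one_step[OF i(2), of "S i \<omega>"] by (simp add: \<psi>_def S_def)
    have "\<psi> (Suc i) \<in> bLip_block (Suc i)"
      unfolding \<psi>_def using l C by (intro cosh_min_infdist_sum_in_bLip_block) auto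
    then have "upper_expectation \<P> (\<lambda>\<omega>. \<psi> (Suc i) (\<lambda>j. X j \<omega>)) = upper_expectation \<P> ?g"
      using indep i unfolding independent_under_def by auto
    also have "\<dots> \<le> D ^ Suc i"
      unfolding upper_expectation_def[of \<P> ?g]
    proof (rule cSUP_least[OF ne])
      fix P assume P: "P \<in> \<P>"
      \<comment> \<open>The inner upper expectation, a function of the first \<open>i\<close>
        variables, is dominated a.s. by \<open>D\<close> times the previous test function.
        Measurability of \<open>?g\<close> is not at issue: if it is not integrable, its integral is
        0, below that of the nonnegative majorant.\<close>
      have "(\<integral>\<omega>. ?g \<omega> \<partial>P) \<le> (\<integral>\<omega>. \<psi> i (\<lambda>j. X j \<omega>) * D \<partial>P)"
      proof (rule integral_mono_AE')
        show "integrable P (\<lambda>\<omega>. \<psi> i (\<lambda>j. X j \<omega>) * D)"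
          using \<psi>_int[OF P, of i] i by simp
        show "AE \<omega> in P. ?g \<omega> \<le> \<psi> i (\<lambda>j. X j \<omega>) * D"
          using \<psi>_eq[OF P, of i] i g by (auto elim: AE_mp)
        show "AE \<omega> in P. 0 \<le> \<psi> i (\<lambda>j. X j \<omega>) * D"
          using D by (simp add: \<psi>_def)
      qed
      also have "\<dots> = (\<integral>\<omega>. \<psi> i (\<lambda>j. X j \<omega>) \<partial>P) * D" by simp
      also have "\<dots> \<le> D ^ i * D"
        using \<psi>_upper[OF P, of i] step.IH i D by (intro mult_right_mono) auto
      finally show "(\<integral>\<omega>. ?g \<omega> \<partial>P) \<le> D ^ Suc i" by (simp add: mult.commute)
    qed
    finally show ?case .
  qed
  define A where "A = {\<omega>. infdist ((1 / real n) *\<^sub>R (\<Sum>i=1..n. X i \<omega>)) (avg_mean_set \<P> n X) > t}"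
  have A: "\<omega> \<in> A \<longleftrightarrow> real n * t < infdist (S n \<omega>) (K n)" for \<omega>
  proof -
    have "sum_mean_set \<P> n X \<noteq> {}" using sum\<theta>[of n] by (auto simp: K_def)
    from infdist_avg_mean_set[OF n this, of "S n \<omega>"] show ?thesis
      using n by (simp add: A_def S_def K_def pos_less_divide_eq mult.commute)
  qed
  define c where "c = cosh (l * (real n * t))"
  have c: "0 < c" by (simp add: c_def)
  have "measure P A \<le> D ^ n / c" if P: "P \<in> \<P>" for P
  proof -
    interpret prob_space P using prob[OF P] .
    have "measure P A * c \<le> (\<integral>\<omega>. \<psi> n (\<lambda>j. X j \<omega>) \<partial>P)"
    \<comment> \<open>This is Markov's inequality; a set outside \<open>sets P\<close> has measure 0
      by default.\<close>
    proof (cases "A \<in> sets P")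
      case True
      then have "measure P A * c = (\<integral>\<omega>. indicator A \<omega> * c \<partial>P)"
        by (simp add: Int_absorb2 sets.sets_into_space)
      also have "\<dots> \<le> (\<integral>\<omega>. \<psi> n (\<lambda>j. X j \<omega>) \<partial>P)"
      proof (rule integral_mono_AE')
        show "integrable P (\<lambda>\<omega>. \<psi> n (\<lambda>j. X j \<omega>))" by (rule \<psi>_int[OF P order_refl])
        show "AE \<omega> in P. indicator A \<omega> * c \<le> \<psi> n (\<lambda>j. X j \<omega>)"
          using \<psi>_eq[OF P order_refl]
        proof eventually_elim
          case (elim \<omega>)
          have "c \<le> cosh (l * infdist (S n \<omega>) (K n))" if "\<omega> \<in> A"
            unfolding c_def using that A[of \<omega>] l t
            by (subst cosh_real_nonneg_le_iff) (auto simp: infdist_nonneg)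
          then show ?case
            using elim by (auto split: split_indicator)
        qed
      qed (simp add: \<psi>_def)
      finally show ?thesis .
    qed (simp add: measure_notin_sets \<psi>_def)
    also have "\<dots> \<le> D ^ n"
      using \<psi>_upper[OF P, of n] main[of n] n by simp
    finally show ?thesis using c by (simp add: field_simps)
  qed
  then have "upper_capacity \<P> A \<le> D ^ n / c"
    unfolding upper_capacity_def by (rule cSUP_least[OF ne])
  \<comment> \<open>The constant 2 arises here, from bounding the cosh in the denominator below by
    half an exponential.\<close>
  also have "\<dots> \<le> exp (real n * (\<kappa> * l\<^sup>2 * s)) / (exp (l * (real n * t)) / 2)"
  proof (rule frac_le)
    have "D ^ n \<le> exp (\<kappa> * l\<^sup>2 * s) ^ n"
      using D unfolding D_def by (intro power_mono exp_ge_add_one_self) auto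
    then show "D ^ n \<le> exp (real n * (\<kappa> * l\<^sup>2 * s))" by (simp add: exp_of_nat_mult)
    show "exp (l * (real n * t)) / 2 \<le> c" by (simp add: c_def cosh_def)
  qed auto
  also have "\<dots> = 2 * exp (real n * (\<kappa> * l\<^sup>2 * s - l * t))"
    by (simp add: exp_diff algebra_simps)
  also have "\<dots> \<le> 2 * exp (real n * - (t\<^sup>2 / (2 * s + 4 * M * t / 3)))"
    using mult_left_mono[OF opt, of "real n"] by simp
  finally show ?thesis by (simp add: A_def s_def)
qed

section \<open>Transfer to the regular sublinear expectation\<close>

theorem theorem5p1:
  fixes E :: "('a::polish_space \<Rightarrow> real) \<Rightarrow> real"
    and \<P> :: "'a measure set"
    and X :: "nat \<Rightarrow> 'a \<Rightarrow> real ^ 'd"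
    and n :: nat and M t :: real
  assumes "regular_sublinear_expectation E"
    and "represents \<P> E"
    and "n \<ge> 1"
    and "\<And>i. i \<in> {1..n} \<Longrightarrow> X i \<in> Lp_vec \<P> 2"
    and "independent_under \<P> n X"
    and "M > 0"
    and "\<And>i P. i \<in> {1..n} \<Longrightarrow> P \<in> \<P> \<Longrightarrow> AE \<omega> in P. norm (X i \<omega>) \<le> M"
    and "t > 0"
  shows "upper_capacity \<P>
           {\<omega>. infdist ((1 / real n) *\<^sub>R (\<Sum>i=1..n. X i \<omega>)) (avg_mean_set \<P> n X) > t}
         \<le> (real CARD('d) + 1) *
            exp (- (real n * t\<^sup>2 / (2 * max_variance \<P> n X + 4 * M * t / 3)))"
proof -
  have probs: "prob_space P" "sets P = sets borel" if "P \<in> \<P>" for P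
    using assms(2) that by (auto simp: represents_def borel_probs_def)
  \<comment> \<open>Over an empty family every function has the same upper expectation, which
    contradicts the preservation of the constants 0 and 1.\<close>
  have ne: "\<P> \<noteq> {}"
  proof
    assume "\<P> = {}"
    moreover have "E (\<lambda>_. c) = upper_expectation \<P> (\<lambda>_. c)" for c :: real
    proof -
      have "(\<lambda>_::'a. c) \<in> bLip"
        by (auto simp: bLip_def intro!: exI[of _ 0] lipschitz_onI)
      then show ?thesis using assms(2) by (simp add: represents_def)
    qed
    ultimately have "E (\<lambda>_. 0) = E (\<lambda>_. 1)" by (simp add: upper_expectation_def)
    moreover have "E (\<lambda>_. c) = c" for c
      using assms(1) by (simp add: regular_sublinear_expectation_def)
    ultimately show False by simp
  qed
  have meas: "X i \<in> borel_measurable P" if "i \<in> {1..n}" "P \<in> \<P>" for i P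
  proof -
    have "(\<lambda>\<omega>. X i \<omega> $ j) \<in> borel_measurable borel" for j
      using assms(4)[OF that(1)] by (simp add: Lp_vec_def Lp_def)
    then have "X i \<in> borel_measurable borel"
      by (subst borel_measurable_euclidean_space) (auto simp: Basis_vec_def inner_axis)
    then show ?thesis using probs(2)[OF that(2)] by (simp cong: measurable_cong_sets)
  qed
  have "upper_capacity \<P>
      {\<omega>. infdist ((1 / real n) *\<^sub>R (\<Sum>i=1..n. X i \<omega>)) (avg_mean_set \<P> n X) > t}
    \<le> 2 * exp (- (real n * t\<^sup>2 / (2 * max_variance \<P> n X + 4 * M * t / 3)))"
    by (rule upper_capacity_infdist_le[OF ne probs(1) assms(3) meas assms(5,6,7,8)])
  also have "\<dots> \<le> (real CARD('d) + 1) * exp (- (real n * t\<^sup>2 / (2 * max_variance \<P> n X + 4 * M * t / 3)))"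
    using zero_less_card_finite[where 'a = 'd] by (intro mult_right_mono) auto
  finally show ?thesis .
qed

end
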